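(* If $M$ is a connected complex manifold which admits a nonconstant holomorphic function $h:M\to\mathbb{C}$, then the ring $H(M)$ of holomorphic functions on $M$ is ample.
   Context: Let $\mathbb{N}=\{1,2,3,\dots\}$ and fix a nonprincipal ultrafilter $\omega$ on $\mathbb{N}$. Let ${}^{*}\mathbb{R}=\prod_{k\in\mathbb{N}}\mathbb{R}/\omega$ be the corresponding ultrapower (ordered field); $[x_k]$ denotes the class of the sequence $(x_k)$, where two sequences are equivalent if they agree on a set belonging to $\omega$. The same notation $[x_k]$ is used for sequences in $[0,\infty]$. Let ${}^{*}\mathbb{N}\subset{}^{*}\mathbb{R}$ be the set of classes $[n_k]$ of sequences of natural numbers. A valuation on a unital ring $R$ is a map $\nu:R\to[0,\infty)\cup\{\infty\}$ such that (1) $\nu(a+b)\ge\min(\nu(a),\nu(b))$; (2) $\nu(ab)=\nu(a)+\nu(b)$; (3) $\nu(a)=\infty\iff a=0$; (4) $\nu(1)=0$. A commutative unital ring $R$ is ample if there exists a sequence of valuations $(\nu_k)_{k\in\mathbb{N}}$ on $R$ such that for each $\beta\in{}^{*}\mathbb{N}$ there is $a=a_\beta\in R$ with $[\nu_k(a)]=\beta$. *)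

theory Defs
  imports "HOL-Analysis.Analysis" "HOL-Algebra.Ring"
begin

section \<open>Ultrapowers\<close>

text \<open>
  The natural numbers of the source start at 1. Ultrafilters on \<open>{1, 2, \<dots>}\<close> are represented as
  filters on type \<^typ>\<open>nat\<close>: a nonprincipal ultrafilter on \<^typ>\<open>nat\<close> does not contain \<open>{0}\<close>, so it is
  the same thing as a nonprincipal ultrafilter on \<open>{1, 2, \<dots>}\<close>, and the entry at index 0 of a
  sequence never matters.
\<close>

definition nonprincipal_ultrafilter :: "'i filter \<Rightarrow> bool" where
  "nonprincipal_ultrafilter \<omega> \<longleftrightarrow>
     \<omega> \<noteq> bot \<and>
     (\<forall>P. eventually P \<omega> \<or> eventually (\<lambda>k. \<not> P k) \<omega>) \<and>
     (\<forall>j. \<not> eventually (\<lambda>k. k = j) \<omega>)"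

definition ultra_class :: "'i filter \<Rightarrow> ('i \<Rightarrow> 'b) \<Rightarrow> ('i \<Rightarrow> 'b) set" where
  "ultra_class \<omega> x = {y. eventually (\<lambda>k. x k = y k) \<omega>}"

text \<open>
  The type \<open>'b\<close> is the ambient set of values: \<^typ>\<open>real\<close> gives the hypernaturals as a subset of the
  hyperreals, \<^typ>\<open>ennreal\<close> as a subset of the ultrapower of \<open>[0,\<infinity>]\<close>, where classes of sequences
  of valuations live.
\<close>

definition hypernat :: "nat filter \<Rightarrow> (nat \<Rightarrow> 'b::semiring_1) set set" where
  "hypernat \<omega> = {ultra_class \<omega> (\<lambda>k. of_nat (n k)) | n. \<forall>k. n k \<ge> 1}"


section \<open>Valuations and ample rings\<close>

definition valuation :: "('a, 'm) ring_scheme \<Rightarrow> ('a \<Rightarrow> ennreal) \<Rightarrow> bool" where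
  "valuation R \<nu> \<longleftrightarrow>
     (\<forall>a \<in> carrier R. \<forall>b \<in> carrier R. \<nu> (a \<oplus>\<^bsub>R\<^esub> b) \<ge> min (\<nu> a) (\<nu> b)) \<and>
     (\<forall>a \<in> carrier R. \<forall>b \<in> carrier R. \<nu> (a \<otimes>\<^bsub>R\<^esub> b) = \<nu> a + \<nu> b) \<and>
     (\<forall>a \<in> carrier R. \<nu> a = \<infinity> \<longleftrightarrow> a = \<zero>\<^bsub>R\<^esub>) \<and>
     \<nu> \<one>\<^bsub>R\<^esub> = 0"

definition ample :: "nat filter \<Rightarrow> ('a, 'm) ring_scheme \<Rightarrow> bool" where
  "ample \<omega> R \<longleftrightarrow> cring R \<and>
     (\<exists>\<nu> :: nat \<Rightarrow> 'a \<Rightarrow> ennreal.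
        (\<forall>k\<ge>1. valuation R (\<nu> k)) \<and>
        (\<forall>\<beta> \<in> hypernat \<omega>. \<exists>a \<in> carrier R. ultra_class \<omega> (\<lambda>k. \<nu> k a) = \<beta>))"


section \<open>Complex manifolds and their holomorphic functions\<close>

text \<open>Holomorphy in several variables, for open \<open>S\<close>: the Frechet derivative exists at every point
  of \<open>S\<close> and is complex-linear.\<close>

definition holomorphic_Cn :: "(complex ^ 'n::finite \<Rightarrow> complex) \<Rightarrow> (complex ^ 'n) set \<Rightarrow> bool" where
  "holomorphic_Cn f S \<longleftrightarrow>
     (\<forall>z \<in> S. \<exists>D. (f has_derivative D) (at z) \<and> (\<forall>c v. D (c *s v) = c * D v))"

definition holomorphic_map_Cn ::
    "(complex ^ 'n::finite \<Rightarrow> complex ^ 'm::finite) \<Rightarrow> (complex ^ 'n) set \<Rightarrow> bool" where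
  "holomorphic_map_Cn F S \<longleftrightarrow> (\<forall>i. holomorphic_Cn (\<lambda>z. F z $ i) S)"

text \<open>
  A complex manifold with underlying space \<open>X\<close>, of dimension \<open>CARD('n)\<close>, given by a holomorphic
  atlas \<open>\<A>\<close> of charts \<open>(U, \<phi>)\<close>. Second countability is not required, so the manifolds in the
  narrower sense (Hausdorff and second countable) are included. Since index types are nonempty, only
  dimension 0 is left out, where a connected manifold is a single point.
\<close>

definition complex_manifold ::
    "'a topology \<Rightarrow> ('a set \<times> ('a \<Rightarrow> complex ^ 'n::finite)) set \<Rightarrow> bool" where
  "complex_manifold X \<A> \<longleftrightarrow>
     Hausdorff_space X \<and>
     (\<Union>(U, \<phi>) \<in> \<A>. U) = topspace X \<and>
     (\<forall>(U, \<phi>) \<in> \<A>. openin X U \<and> open (\<phi> ` U) \<and>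
        homeomorphic_map (subtopology X U) (top_of_set (\<phi> ` U)) \<phi>) \<and>
     (\<forall>(U, \<phi>) \<in> \<A>. \<forall>(V, \<psi>) \<in> \<A>.
        holomorphic_map_Cn (\<psi> \<circ> inv_into U \<phi>) (\<phi> ` (U \<inter> V)))"

definition holomorphic_fun ::
    "'a topology \<Rightarrow> ('a set \<times> ('a \<Rightarrow> complex ^ 'n::finite)) set \<Rightarrow> ('a \<Rightarrow> complex) \<Rightarrow> bool" where
  "holomorphic_fun X \<A> f \<longleftrightarrow>
     (\<forall>(U, \<phi>) \<in> \<A>. holomorphic_Cn (f \<circ> inv_into U \<phi>) (\<phi> ` U))"

text \<open>Elements of the ring are extensional, so that equality of functions on \<open>topspace X\<close> is
  equality in the ring.\<close>

definition holomorphic_ring ::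
    "'a topology \<Rightarrow> ('a set \<times> ('a \<Rightarrow> complex ^ 'n::finite)) set \<Rightarrow> ('a \<Rightarrow> complex) ring" where
  "holomorphic_ring X \<A> =
     \<lparr>carrier = {f \<in> extensional (topspace X). holomorphic_fun X \<A> f},
      mult = (\<lambda>f g. \<lambda>x\<in>topspace X. f x * g x),
      one = (\<lambda>x\<in>topspace X. 1),
      zero = (\<lambda>x\<in>topspace X. 0),
      add = (\<lambda>f g. \<lambda>x\<in>topspace X. f x + g x)\<rparr>"

end

theory Submission
  imports Defs "HOL-Complex_Analysis.Complex_Analysis"
begin

text \<open>
  There is an unbounded holomorphic function \<open>H\<close> on \<open>M\<close>: either \<open>h\<close> itself, or \<open>1 / (h - z)\<close> for a
  point \<open>z\<close> in the closure of \<open>h(M)\<close> but outside \<open>h(M)\<close>, which exists for bounded \<open>h\<close> since by the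
  maximum principle \<open>h(M)\<close> is not compact. Choose points \<open>p\<^sub>k\<close> such that the moduli of
  \<open>z\<^sub>k = H(p\<^sub>k)\<close> increase to infinity, and let \<open>\<nu>\<^sub>k(g)\<close> be the order of vanishing of \<open>g\<close> at \<open>p\<^sub>k\<close>
  divided by that of \<open>H - z\<^sub>k\<close>. If \<open>F\<close> is a Weierstrass product with a zero of order exactly \<open>n\<^sub>k\<close>
  at each \<open>z\<^sub>k\<close>, then \<open>\<nu>\<^sub>k(F \<circ> H) = n\<^sub>k\<close> for all \<open>k\<close>.

  The order of vanishing in several variables is the least order along complex lines. Its
  additivity holds because the leading Taylor coefficient along a line depends holomorphically on
  the direction, so that two functions attain their minimal orders along a common line.
\<close>

section \<open>Holomorphic functions of several variables\<close>

lemma norm_vector_smult: "norm (c *s v) = norm c * norm (v :: complex ^ 'n::finite)"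
  by (simp add: norm_vec_def L2_set_def norm_mult power_mult_distrib real_sqrt_mult
      flip: sum_distrib_left)

lemma dist_line: "dist p (p + t *s v) = norm t * norm (v :: complex ^ 'n::finite)"
  by (simp add: dist_norm norm_vector_smult)

lemma bounded_linear_smult_left: "bounded_linear (\<lambda>c. c *s (v :: complex ^ 'n::finite))"
  by (rule bounded_linear_intro[where K = "norm v"])
    (auto simp: norm_vector_smult vec_eq_iff algebra_simps mult.commute)

lemma continuous_on_line: "continuous_on UNIV (\<lambda>t. p + t *s (v :: complex ^ 'n::finite))"
  by (intro continuous_intros linear_continuous_on bounded_linear_smult_left)

lemma open_line_preimage:
  fixes v :: "complex ^ 'n::finite"
  assumes "open S"
  shows "open {t. p + t *s v \<in> S}"
  using open_vimage[OF assms continuous_on_line] by (simp add: vimage_def)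

lemma convex_line_preimage:
  fixes v :: "complex ^ 'n::finite"
  assumes "convex S"
  shows "convex {t. p + t *s v \<in> S}"
proof (rule convexI, safe)
  fix x y u w assume *: "p + x *s v \<in> S" "p + y *s v \<in> S" "0 \<le> (u::real)" "0 \<le> w" "u + w = 1"
  have "p + (u *\<^sub>R x + w *\<^sub>R y) *s v = (u + w) *\<^sub>R p + (u *\<^sub>R x + w *\<^sub>R y) *s v"
    using * by simp
  also have "\<dots> = u *\<^sub>R (p + x *s v) + w *\<^sub>R (p + y *s v)"
    by (simp add: vec_eq_iff algebra_simps)
  also have "\<dots> \<in> S" using * assms by (intro convexD)
  finally show "p + (u *\<^sub>R x + w *\<^sub>R y) *s v \<in> S" .
qed

text \<open>Complex linearity of \<open>D\<close> turns the derivative of the restriction into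
  multiplication by the number \<open>D v\<close>. This is the bridge to one-variable function
  theory.\<close>

lemma holomorphic_Cn_line:
  assumes "holomorphic_Cn f S"
  shows "(\<lambda>t. f (p + t *s v)) holomorphic_on {t. p + t *s v \<in> S}"
proof (rule holomorphic_onI, safe)
  fix t assume "p + t *s v \<in> S"
  then obtain D where D: "(f has_derivative D) (at (p + t *s v))" "\<And>c v. D (c *s v) = c * D v"
    using assms unfolding holomorphic_Cn_def by metis
  have "((\<lambda>t. p + t *s v) has_derivative (\<lambda>t. t *s v)) (at t)"
    using has_derivative_add[OF has_derivative_const
        bounded_linear_imp_has_derivative[OF bounded_linear_smult_left]] by simp
  from has_derivative_compose[OF this D(1)]
  have "((\<lambda>t. f (p + t *s v)) has_derivative (\<lambda>t. D v * t)) (at t)"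
    by (simp add: D(2) mult.commute)
  then show "(\<lambda>t. f (p + t *s v)) field_differentiable at t within {t. p + t *s v \<in> S}"
    by (meson field_differentiable_at_within field_differentiable_def has_field_derivative_def)
qed

section \<open>Closure properties of holomorphic functions of several variables\<close>

lemma holomorphic_Cn_subset: "holomorphic_Cn f S \<Longrightarrow> T \<subseteq> S \<Longrightarrow> holomorphic_Cn f T"
  unfolding holomorphic_Cn_def by blast

lemma holomorphic_Cn_cong:
  assumes "open S" "\<And>z. z \<in> S \<Longrightarrow> f z = g z" "holomorphic_Cn f S"
  shows "holomorphic_Cn g S"
  using assms unfolding holomorphic_Cn_def by (metis has_derivative_transform_within_open)

lemma holomorphic_Cn_imp_continuous_on: "holomorphic_Cn f S \<Longrightarrow> continuous_on S f"
  unfolding holomorphic_Cn_def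
  by (meson continuous_at_imp_continuous_on has_derivative_continuous)

lemma holomorphic_Cn_const: "holomorphic_Cn (\<lambda>_. c) S"
  unfolding holomorphic_Cn_def by (auto intro!: exI[of _ "\<lambda>_. 0"])

lemma holomorphic_Cn_add:
  assumes "holomorphic_Cn f S" "holomorphic_Cn g S"
  shows "holomorphic_Cn (\<lambda>z. f z + g z) S"
  unfolding holomorphic_Cn_def
proof
  fix z assume "z \<in> S"
  then obtain D E where "(f has_derivative D) (at z)" "\<forall>c v. D (c *s v) = c * D v"
    "(g has_derivative E) (at z)" "\<forall>c v. E (c *s v) = c * E v"
    using assms unfolding holomorphic_Cn_def by metis
  then show "\<exists>D. ((\<lambda>z. f z + g z) has_derivative D) (at z) \<and> (\<forall>c v. D (c *s v) = c * D v)"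
    by (intro exI[of _ "\<lambda>h. D h + E h"]) (auto intro: has_derivative_add simp: algebra_simps)
qed

lemma holomorphic_Cn_mult:
  assumes "holomorphic_Cn f S" "holomorphic_Cn g S"
  shows "holomorphic_Cn (\<lambda>z. f z * g z) S"
  unfolding holomorphic_Cn_def
proof
  fix z assume "z \<in> S"
  then obtain D E where "(f has_derivative D) (at z)" "\<forall>c v. D (c *s v) = c * D v"
    "(g has_derivative E) (at z)" "\<forall>c v. E (c *s v) = c * E v"
    using assms unfolding holomorphic_Cn_def by metis
  then show "\<exists>D. ((\<lambda>z. f z * g z) has_derivative D) (at z) \<and> (\<forall>c v. D (c *s v) = c * D v)"
    by (intro exI[of _ "\<lambda>h. f z * E h + D h * g z"] conjI has_derivative_mult)
      (auto simp: algebra_simps)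
qed

lemma holomorphic_Cn_compose:
  assumes "holomorphic_Cn f S" "g holomorphic_on T" "open T" "f ` S \<subseteq> T"
  shows "holomorphic_Cn (\<lambda>z. g (f z)) S"
  unfolding holomorphic_Cn_def
proof
  fix z assume "z \<in> S"
  then obtain D where D: "(f has_derivative D) (at z)" "\<forall>c v. D (c *s v) = c * D v"
    using assms unfolding holomorphic_Cn_def by metis
  have "(g has_field_derivative deriv g (f z)) (at (f z))"
    using assms \<open>z \<in> S\<close> by (auto intro: holomorphic_derivI)
  then have "(g has_derivative (\<lambda>t. deriv g (f z) * t)) (at (f z))"
    by (simp add: has_field_derivative_def)
  from has_derivative_compose[OF D(1) this] D(2)
  show "\<exists>D. ((\<lambda>z. g (f z)) has_derivative D) (at z) \<and> (\<forall>c v. D (c *s v) = c * D v)"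
    by (intro exI[of _ "\<lambda>h. deriv g (f z) * D h"]) auto
qed

text \<open>Identity theorem, reduced to one variable on the complex line through \<open>q\<close>
  and \<open>z\<close>: convexity makes the preimage of \<open>S\<close> connected, and the preimage
  of \<open>T\<close> is an open set containing 0.\<close>

lemma holomorphic_Cn_eq_0:
  fixes f :: "complex ^ 'n::finite \<Rightarrow> complex"
  assumes f: "holomorphic_Cn f S" and S: "open S" "convex S"
    and T: "open T" "q \<in> T" "T \<subseteq> S" "\<And>z. z \<in> T \<Longrightarrow> f z = 0" and z: "z \<in> S"
  shows "f z = 0"
proof -
  define v where "v = z - q"
  have "f (q + t *s v) = 0" if "q + t *s v \<in> S" for t
    by (rule analytic_continuation_open[of "{t. q + t *s v \<in> T}" "{t. q + t *s v \<in> S}"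
          "\<lambda>t. f (q + t *s v)" "\<lambda>_. 0"])
      (use T that in \<open>auto intro!: open_line_preimage S convex_connected convex_line_preimage
        holomorphic_Cn_line f exI[of _ 0]\<close>)
  from this[of 1] z show ?thesis by (simp add: v_def)
qed

text \<open>Same reduction: on the complex line through \<open>p\<close> and \<open>z\<close> the
  modulus has an interior maximum at parameter 0, so the restriction is constant up to parameter 1,
  which is \<open>z\<close>.\<close>

lemma holomorphic_Cn_maximum_modulus:
  fixes f :: "complex ^ 'n::finite \<Rightarrow> complex"
  assumes f: "holomorphic_Cn f S" and S: "open S" "convex S" "p \<in> S"
    and max: "\<And>z. z \<in> S \<Longrightarrow> norm (f z) \<le> norm (f p)" and z: "z \<in> S"
  shows "f z = f p"
proof -
  define v where "v = z - p"
  let ?L = "{t. p + t *s v \<in> S}"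
  have "(\<lambda>t. f (p + t *s v)) constant_on ?L"
    by (rule maximum_modulus_principle[where \<xi> = 0 and U = ?L])
      (use S max in \<open>auto intro!: open_line_preimage S convex_connected convex_line_preimage
        holomorphic_Cn_line f\<close>)
  then obtain c where c: "\<And>t. t \<in> ?L \<Longrightarrow> f (p + t *s v) = c"
    unfolding constant_on_def by blast
  from c[of 0] c[of 1] S z show ?thesis by (simp add: v_def)
qed

section \<open>Order of vanishing\<close>

text \<open>For \<open>f\<close> holomorphic near \<open>p\<close> this is \<open>m!\<close> times
  the homogeneous Taylor part of degree \<open>m\<close>, evaluated at \<open>v\<close>. Defining it
  through one variable avoids multivariate Taylor series.\<close>

definition line_deriv :: "(complex ^ 'n::finite \<Rightarrow> complex) \<Rightarrow> complex ^ 'n \<Rightarrow> nat \<Rightarrow> complex ^ 'n \<Rightarrow> complex"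
  where "line_deriv f p m v = (deriv ^^ m) (\<lambda>t. f (p + t *s v)) 0"

text \<open>In the Taylor expansion in \<open>t\<close> the terms below degree \<open>m\<close>
  vanish, so the quotient differs from the leading coefficient by the remainder only. The point is
  that \<open>B\<close> is the same for all directions of norm at most \<open>K\<close>.\<close>

lemma leading_line_deriv_limit:
  fixes f :: "complex ^ 'n::finite \<Rightarrow> complex"
  assumes f: "holomorphic_Cn f (ball p \<rho>)" and "\<rho> > 0" and "K > 0"
    and low: "\<And>j v. j < m \<Longrightarrow> line_deriv f p j v = 0"
  obtains r B where "r > 0" "r * K < \<rho>"
    "\<And>t v. norm v \<le> K \<Longrightarrow> 0 < norm t \<Longrightarrow> norm t \<le> r \<Longrightarrow>
       norm (fact m * f (p + t *s v) / t ^ m - line_deriv f p m v) \<le> B * norm t"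
proof -
  \<comment> \<open>Parameters of modulus up to \<open>2 * r\<close> stay in the closed ball of
    radius \<open>\<rho> / 2\<close>, which leaves room for Cauchy discs of radius \<open>r\<close>
    around every parameter in \<open>cball 0 r\<close>.\<close>
  define r where "r = \<rho> / (4 * K)"
  have r: "r > 0" "2 * r * K = \<rho> / 2" using assms by (auto simp: r_def field_simps)
  have "compact (f ` cball p (\<rho> / 2))"
    using \<open>\<rho> > 0\<close>
    by (intro compact_continuous_image continuous_on_subset[OF holomorphic_Cn_imp_continuous_on[OF f]]) auto
  then obtain C where C: "\<And>z. z \<in> cball p (\<rho> / 2) \<Longrightarrow> norm (f z) \<le> C"
    by (meson bounded_iff compact_imp_bounded imageI)
  \<comment> \<open>Cauchy's bound for the derivative of order \<open>m + 1\<close>. It is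
    independent of the direction because \<open>C\<close> bounds \<open>f\<close> on a whole compact
    ball.\<close>
  define B where "B = fact (Suc m) * C / r ^ Suc m"
  show thesis
  proof
    show "r > 0" by fact
    show "r * K < \<rho>" using r \<open>\<rho> > 0\<close> by simp
    fix t :: complex and v :: "complex ^ 'n"
    assume v: "norm v \<le> K" and t: "0 < norm t" "norm t \<le> r"
    define g where "g = (\<lambda>t. f (p + t *s v))"
    have in_half: "p + x *s v \<in> cball p (\<rho> / 2)" if "norm x \<le> 2 * r" for x
      using mult_mono[OF that v] r by (simp add: dist_line)
    have hol: "g holomorphic_on {x. p + x *s v \<in> ball p \<rho>}"
      unfolding g_def by (rule holomorphic_Cn_line[OF f])
    have sub: "cball 0 (2 * r) \<subseteq> {x. p + x *s v \<in> ball p \<rho>}"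
      using in_half \<open>\<rho> > 0\<close> by fastforce
    have bound: "norm ((deriv ^^ Suc m) g x) \<le> B" if "x \<in> cball 0 r" for x
      unfolding B_def
    proof (rule Cauchy_inequality)
      have s: "cball x r \<subseteq> cball 0 (2 * r)"
        using that by (intro cball_subset_cball_iff[THEN iffD2]) auto
      show "g holomorphic_on ball x r" "continuous_on (cball x r) g"
        using s sub hol by (meson ball_subset_cball holomorphic_on_imp_continuous_on
            holomorphic_on_subset subset_trans)+
      show "norm (g y) \<le> C" if "norm (x - y) = r" for y
        using C[OF in_half, of y] that s by (auto simp: g_def dist_norm subset_iff)
    qed fact
    have "norm ((deriv ^^ 0) g t - (\<Sum>i\<le>m. (deriv ^^ i) g 0 * (t - 0) ^ i / fact i))
        \<le> B * norm (t - 0) ^ Suc m / fact m"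
    proof (rule complex_Taylor[of "cball 0 r"])
      fix i x assume "x \<in> cball (0::complex) r" 
      then have "x \<in> cball 0 (2 * r)" using r(1) by simp
      then have "x \<in> {x. p + x *s v \<in> ball p \<rho>}" using sub by blast
      then show "((deriv ^^ i) g has_field_derivative (deriv ^^ Suc i) g x) (at x within cball 0 r)"
        using has_field_derivative_higher_deriv[OF hol open_line_preimage[OF open_ball]]
        by (auto intro: has_field_derivative_at_within)
    qed (use bound t r in auto)
    moreover have "(\<Sum>i\<le>m. (deriv ^^ i) g 0 * t ^ i / fact i) = line_deriv f p m v * t ^ m / fact m"
      using low by (subst sum.remove[of _ m]) (auto simp: line_deriv_def g_def intro!: sum.neutral)
    ultimately have *: "norm (g t - line_deriv f p m v * t ^ m / fact m) \<le> B * norm t ^ Suc m / fact m"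
      by simp
    have "norm (fact m * g t / t ^ m - line_deriv f p m v)
        = norm (g t - line_deriv f p m v * t ^ m / fact m) * (fact m / norm t ^ m)"
    proof -
      have "fact m * g t / t ^ m - line_deriv f p m v
        = (g t - line_deriv f p m v * t ^ m / fact m) * (fact m / t ^ m)"
        using t by (simp add: field_simps)
      then show ?thesis by (simp add: norm_mult norm_divide norm_power)
    qed
    also have "\<dots> \<le> B * norm t ^ Suc m / fact m * (fact m / norm t ^ m)"
      by (intro mult_right_mono *) auto
    also have "\<dots> = B * norm t" using t by (simp add: field_simps)
    finally show "norm (fact m * f (p + t *s v) / t ^ m - line_deriv f p m v) \<le> B * norm t"
      by (simp add: g_def)
  qed
qed

text \<open>Holomorphy in \<open>s\<close> makes the one-variable identity theorem available on a
  complex line of directions. The vanishing of all lower coefficients is what lets the rescaled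
  quotients converge.\<close>

lemma holomorphic_leading_line_deriv:
  fixes f :: "complex ^ 'n::finite \<Rightarrow> complex"
  assumes f: "holomorphic_Cn f (ball p \<rho>)" and "\<rho> > 0"
    and low: "\<And>j v. j < m \<Longrightarrow> line_deriv f p j v = 0"
  shows "(\<lambda>s. line_deriv f p m (v + s *s w)) holomorphic_on ball 0 R"
proof -
  \<comment> \<open>A bound for all directions \<open>v + s *s w\<close> with \<open>s\<close> in
    \<open>ball 0 R\<close>; the summand 1 keeps it positive.\<close>
  define K where "K = norm v + \<bar>R\<bar> * norm w + 1"
  have "K > 0" by (simp add: K_def add_nonneg_pos)
  obtain r B where r: "r > 0" "r * K < \<rho>"
    and B: "\<And>t v. norm v \<le> K \<Longrightarrow> 0 < norm t \<Longrightarrow> norm t \<le> r \<Longrightarrow>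
       norm (fact m * f (p + t *s v) / t ^ m - line_deriv f p m v) \<le> B * norm t"
    using leading_line_deriv_limit[OF f \<open>\<rho> > 0\<close> \<open>K > 0\<close> low] by metis
  have dir: "norm (v + s *s w) \<le> K" if "s \<in> ball 0 R" for s
  proof -
    have "norm (v + s *s w) \<le> norm v + norm s * norm w"
      by (metis norm_triangle_ineq norm_vector_smult)
    also have "norm s * norm w \<le> \<bar>R\<bar> * norm w" using that by (intro mult_right_mono) auto
    finally show ?thesis by (simp add: K_def)
  qed
  \<comment> \<open>The leading coefficient is the uniform limit of the rescaled functions \<open>F n\<close>.\<close>
  define \<tau> :: "nat \<Rightarrow> complex" where "\<tau> n = of_real (r / Suc n)" for n
  have \<tau>: "0 < norm (\<tau> n)" "norm (\<tau> n) \<le> r" "norm (\<tau> n) = r / Suc n" for n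
    using r by (auto simp: \<tau>_def norm_divide field_simps simp del: of_nat_Suc)
  define F where "F n s = fact m * f (p + \<tau> n *s (v + s *s w)) / \<tau> n ^ m" for n s
  have unif: "uniform_limit (ball 0 R) F (\<lambda>s. line_deriv f p m (v + s *s w)) sequentially"
  proof (rule uniform_limitI)
    fix e :: real assume "e > 0"
    have "(\<lambda>n. B * (r / Suc n)) \<longlonglongrightarrow> B * 0"
      by (intro tendsto_intros LIMSEQ_Suc lim_const_over_n)
    then have "\<forall>\<^sub>F n in sequentially. B * (r / Suc n) < e"
      using \<open>e > 0\<close> by (simp add: order_tendstoD(2))
    then show "\<forall>\<^sub>F n in sequentially. \<forall>s\<in>ball 0 R. dist (F n s) (line_deriv f p m (v + s *s w)) < e"
    proof eventually_elim
      case (elim n)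
      show ?case
      proof
        fix s :: complex assume "s \<in> ball 0 R"
        from B[OF dir[OF this] \<tau>(1,2)[of n]] elim
        show "dist (F n s) (line_deriv f p m (v + s *s w)) < e"
          unfolding F_def dist_norm \<tau>(3) by linarith
      qed
    qed
  qed
  show ?thesis
  proof (rule holomorphic_uniform_sequence[of _ F])
    fix n
    \<comment> \<open>For fixed \<open>n\<close> the evaluation point is affine in \<open>s\<close>,
      so \<open>F n\<close> is a restriction of \<open>f\<close> to another complex line, up to a
      constant factor.\<close>
    have eq: "p + \<tau> n *s (v + s *s w) = (p + \<tau> n *s v) + s *s (\<tau> n *s w)" for s
      by (simp add: vec_eq_iff algebra_simps)
    have "p + \<tau> n *s (v + s *s w) \<in> ball p \<rho>" if "s \<in> ball 0 R" for s
      using mult_mono[OF \<tau>(2)[of n] dir[OF that]] r by (simp add: dist_line del: vector_add_ldistrib)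
    then have "(\<lambda>s. f (p + \<tau> n *s (v + s *s w))) holomorphic_on ball 0 R"
      unfolding eq by (intro holomorphic_on_subset[OF holomorphic_Cn_line[OF f]]) auto
    then show "F n holomorphic_on ball 0 R"
      unfolding F_def using \<tau>(1)[of n] by (intro holomorphic_intros) auto
  next
    fix s :: complex assume "s \<in> ball 0 R"
    then obtain d where "d > 0" "cball s d \<subseteq> ball 0 R" using open_contains_cball_eq[OF open_ball] by blast
    then show "\<exists>d>0. cball s d \<subseteq> ball 0 R \<and>
        uniform_limit (cball s d) F (\<lambda>s. line_deriv f p m (v + s *s w)) sequentially"
      using uniform_limit_on_subset[OF unif] by blast
  qed auto
qed

text \<open>Otherwise the leading coefficient of \<open>g\<close> would vanish wherever that of
  \<open>f\<close> does not. This includes a neighbourhood of \<open>v\<close> on the line from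
  \<open>v\<close> to \<open>w\<close>, so by the identity theorem it would vanish at
  \<open>w\<close> too.\<close>

lemma common_direction:
  fixes f g :: "complex ^ 'n::finite \<Rightarrow> complex"
  assumes f: "holomorphic_Cn f (ball p \<rho>)" and g: "holomorphic_Cn g (ball p \<rho>)" and "\<rho> > 0"
    and low: "\<And>j v. j < m \<Longrightarrow> line_deriv f p j v = 0" "\<And>j v. j < l \<Longrightarrow> line_deriv g p j v = 0"
    and v: "line_deriv f p m v \<noteq> 0" and w: "line_deriv g p l w \<noteq> 0"
  shows "\<exists>u. line_deriv f p m u \<noteq> 0 \<and> line_deriv g p l u \<noteq> 0"
proof (rule ccontr)
  assume "\<nexists>u. line_deriv f p m u \<noteq> 0 \<and> line_deriv g p l u \<noteq> 0"
  then have contr: "\<forall>u. \<not> (line_deriv f p m u \<noteq> 0 \<and> line_deriv g p l u \<noteq> 0)" by blast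
  \<comment> \<open>Leading coefficients along the directions of the complex line through \<open>v\<close> and \<open>w\<close>.\<close>
  define A where "A s = line_deriv f p m (v + s *s (w - v))" for s
  define B where "B s = line_deriv g p l (v + s *s (w - v))" for s
  \<comment> \<open>Radius 2 makes the disc contain both \<open>s = 0\<close>, the direction
    \<open>v\<close>, and \<open>s = 1\<close>, the direction \<open>w\<close>.\<close>
  have hol: "A holomorphic_on ball 0 2" "B holomorphic_on ball 0 2"
    unfolding A_def B_def
    by (rule holomorphic_leading_line_deriv[OF f \<open>\<rho> > 0\<close> low(1)], assumption)
      (rule holomorphic_leading_line_deriv[OF g \<open>\<rho> > 0\<close> low(2)], assumption)
  let ?U = "ball 0 2 \<inter> A -` (- {0})"
  have "open ?U"
    by (intro continuous_open_preimage holomorphic_on_imp_continuous_on hol) auto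
  moreover have "0 \<in> ?U" using v by (simp add: A_def)
  ultimately have "0 islimpt ?U" by (metis interior_limit_point interior_open)
  moreover have "B s = 0" if "s \<in> ?U" for s
    using contr[THEN spec, of "v + s *s (w - v)"] that unfolding A_def B_def by blast
  ultimately have "B 1 = 0"
    using analytic_continuation[OF hol(2) open_ball connected_ball, of ?U 0 1] by simp
  with w show False by (simp add: B_def)
qed

section \<open>Rules for derivatives along lines\<close>

lemma line_deriv_cong:
  assumes "open S" "p \<in> S" "\<And>z. z \<in> S \<Longrightarrow> f z = g z"
  shows "line_deriv f p m v = line_deriv g p m v"
  unfolding line_deriv_def
proof (rule higher_deriv_cong_ev)
  have "\<forall>\<^sub>F t in nhds 0. t \<in> {t. p + t *s v \<in> S}"
    using assms by (intro eventually_nhds_in_open open_line_preimage) auto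
  then show "\<forall>\<^sub>F t in nhds 0. f (p + t *s v) = g (p + t *s v)"
    by eventually_elim (use assms in auto)
qed simp

lemma line_deriv_0 [simp]: "line_deriv f p 0 v = f p"
  by (simp add: line_deriv_def)

lemma line_deriv_zero_fun: "line_deriv (\<lambda>_. 0) p m v = 0"
  by (simp add: line_deriv_def)

lemma line_deriv_add:
  assumes "holomorphic_Cn f S" "holomorphic_Cn g S" "open S" "p \<in> S"
  shows "line_deriv (\<lambda>z. f z + g z) p m v = line_deriv f p m v + line_deriv g p m v"
  unfolding line_deriv_def
  by (rule higher_deriv_add[of _ "{t. p + t *s v \<in> S}"])
    (use assms in \<open>auto intro: holomorphic_Cn_line open_line_preimage\<close>)

lemma line_deriv_mult:
  assumes "holomorphic_Cn f S" "holomorphic_Cn g S" "open S" "p \<in> S"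
  shows "line_deriv (\<lambda>z. f z * g z) p m v
    = (\<Sum>i=0..m. of_nat (m choose i) * line_deriv f p i v * line_deriv g p (m - i) v)"
  unfolding line_deriv_def
  by (rule higher_deriv_mult[of _ "{t. p + t *s v \<in> S}"])
    (use assms in \<open>auto intro: holomorphic_Cn_line open_line_preimage\<close>)

text \<open>If all derivatives along the line from \<open>p\<close> to \<open>z\<close> vanished at
  \<open>p\<close>, the restriction to that line would be zero on a connected set containing
  parameter 1, hence at \<open>z\<close>.\<close>

lemma exists_line_deriv_nonzero:
  fixes f :: "complex ^ 'n::finite \<Rightarrow> complex"
  assumes f: "holomorphic_Cn f (ball p \<rho>)" and z: "z \<in> ball p \<rho>" "f z \<noteq> 0"
  shows "\<exists>m v. line_deriv f p m v \<noteq> 0"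
proof (rule ccontr)
  define v where "v = z - p"
  assume "\<nexists>m v. line_deriv f p m v \<noteq> 0"
  then have 0: "(deriv ^^ m) (\<lambda>t. f (p + t *s v)) 0 = 0" for m
    by (simp add: line_deriv_def)
  have "p \<in> ball p \<rho>" using z by (metis centre_in_ball dist_not_less_zero mem_ball not_less order_le_less_trans zero_le_dist)
  then have "f (p + 1 *s v) = 0"
    using holomorphic_fun_eq_0_on_connected[OF holomorphic_Cn_line[OF f]
        open_line_preimage[OF open_ball] convex_connected[OF convex_line_preimage[OF convex_ball]] 0, of 1] z
    by (simp add: v_def)
  with z show False by (simp add: v_def)
qed

text \<open>Meaningful only if some derivative along a line is nonzero. Functions vanishing
  identically near \<open>p\<close> get an unspecified value here; \<open>scaled_order\<close>
  treats the zero function separately.\<close>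

definition vanishing_order :: "(complex ^ 'n::finite \<Rightarrow> complex) \<Rightarrow> complex ^ 'n \<Rightarrow> nat" where
  "vanishing_order f p = (LEAST m. \<exists>v. line_deriv f p m v \<noteq> 0)"

lemma line_deriv_below_vanishing_order: "m < vanishing_order f p \<Longrightarrow> line_deriv f p m v = 0"
  unfolding vanishing_order_def using not_less_Least by blast

lemma vanishing_order_cong:
  assumes "open S" "p \<in> S" "\<And>z. z \<in> S \<Longrightarrow> f z = g z"
  shows "vanishing_order f p = vanishing_order g p"
  unfolding vanishing_order_def using line_deriv_cong[OF assms] by simp

lemma vanishing_order_attained:
  fixes f :: "complex ^ 'n::finite \<Rightarrow> complex"
  assumes "holomorphic_Cn f (ball p \<rho>)" "z \<in> ball p \<rho>" "f z \<noteq> 0"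
  obtains v where "line_deriv f p (vanishing_order f p) v \<noteq> 0"
  using LeastI_ex[OF exists_line_deriv_nonzero[OF assms]] unfolding vanishing_order_def by blast

lemma vanishing_order_eq_0: "f p \<noteq> 0 \<Longrightarrow> vanishing_order f p = 0"
  unfolding vanishing_order_def by (rule Least_eq_0) simp

lemma vanishing_order_pos:
  fixes f :: "complex ^ 'n::finite \<Rightarrow> complex"
  assumes "holomorphic_Cn f (ball p \<rho>)" "z \<in> ball p \<rho>" "f z \<noteq> 0" "f p = 0"
  shows "vanishing_order f p > 0"
  using vanishing_order_attained[OF assms(1-3)] assms(4) by (metis gr0I line_deriv_0)

text \<open>The order of the sum is attained along some direction. Were it below both orders, the
  nonzero coefficient there would be a sum of two zeros.\<close>

lemma vanishing_order_add:
  fixes f g :: "complex ^ 'n::finite \<Rightarrow> complex"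
  assumes f: "holomorphic_Cn f (ball p \<rho>)" and g: "holomorphic_Cn g (ball p \<rho>)"
    and z: "z \<in> ball p \<rho>" "f z + g z \<noteq> 0"
  shows "min (vanishing_order f p) (vanishing_order g p) \<le> vanishing_order (\<lambda>z. f z + g z) p"
proof (rule ccontr)
  assume *: "\<not> ?thesis"
  obtain v where v: "line_deriv (\<lambda>z. f z + g z) p (vanishing_order (\<lambda>z. f z + g z) p) v \<noteq> 0"
    using vanishing_order_attained[OF holomorphic_Cn_add[OF f g] z] .
  have "p \<in> ball p \<rho>" using z by (metis centre_in_ball mem_ball order_le_less_trans zero_le_dist)
  with v show False using *
    by (simp add: line_deriv_add[OF f g open_ball] line_deriv_below_vanishing_order)
qed

text \<open>In the Leibniz sum every term has a factor of order below \<open>m\<close> or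
  \<open>l\<close>, except the term \<open>i = m\<close> in total order
  \<open>m + l\<close>.\<close>

lemma line_deriv_mult_leading:
  assumes "holomorphic_Cn f S" "holomorphic_Cn g S" "open S" "p \<in> S"
    and low: "\<And>j. j < m \<Longrightarrow> line_deriv f p j v = 0" "\<And>j. j < l \<Longrightarrow> line_deriv g p j v = 0"
  shows "line_deriv (\<lambda>z. f z * g z) p (m + l) v
    = of_nat ((m + l) choose m) * line_deriv f p m v * line_deriv g p l v"
    and "k < m + l \<Longrightarrow> line_deriv (\<lambda>z. f z * g z) p k v = 0"
proof -
  have "(\<Sum>i=0..m+l. of_nat ((m+l) choose i) * line_deriv f p i v * line_deriv g p (m + l - i) v)
      = (\<Sum>i=0..m+l. if i = m then of_nat ((m+l) choose m) * line_deriv f p m v * line_deriv g p l v else 0)"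
  proof (rule sum.cong[OF refl])
    fix i assume "i \<in> {0..m+l}"
    then have "i < m \<or> i = m \<or> m + l - i < l" by auto
    then show "of_nat ((m+l) choose i) * line_deriv f p i v * line_deriv g p (m + l - i) v =
      (if i = m then of_nat ((m+l) choose m) * line_deriv f p m v * line_deriv g p l v else 0)"
      using low by auto
  qed
  then show "line_deriv (\<lambda>z. f z * g z) p (m + l) v
    = of_nat ((m + l) choose m) * line_deriv f p m v * line_deriv g p l v"
    unfolding line_deriv_mult[OF assms(1-4)] by simp
  assume "k < m + l"
  then have "i < m \<or> k - i < l" if "i \<in> {0..k}" for i using that by auto
  then show "line_deriv (\<lambda>z. f z * g z) p k v = 0"
    unfolding line_deriv_mult[OF assms(1-4)] using low
    by (intro sum.neutral) (metis mult_eq_0_iff)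
qed

text \<open>All coefficients of total order below \<open>m + l\<close> vanish in every direction,
  and a common direction \<open>u\<close> for both leading coefficients shows that order
  \<open>m + l\<close> is attained. The same nonzero coefficient shows that the product is not
  identically zero.\<close>

lemma vanishing_order_mult:
  fixes f g :: "complex ^ 'n::finite \<Rightarrow> complex"
  assumes f: "holomorphic_Cn f (ball p \<rho>)" and g: "holomorphic_Cn g (ball p \<rho>)"
    and z: "z \<in> ball p \<rho>" "f z \<noteq> 0" and w: "w \<in> ball p \<rho>" "g w \<noteq> 0"
  shows "vanishing_order (\<lambda>z. f z * g z) p = vanishing_order f p + vanishing_order g p"
    and "\<exists>z\<in>ball p \<rho>. f z * g z \<noteq> 0"
proof -
  define m l where "m = vanishing_order f p" and "l = vanishing_order g p"
  have low: "j < m \<Longrightarrow> line_deriv f p j v = 0" "j < l \<Longrightarrow> line_deriv g p j v = 0" for j v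
    by (simp_all add: m_def l_def line_deriv_below_vanishing_order)
  have \<rho>: "\<rho> > 0" using z by (metis mem_ball order_le_less_trans zero_le_dist)
  obtain v w where "line_deriv f p m v \<noteq> 0" "line_deriv g p l w \<noteq> 0"
    using vanishing_order_attained[OF f z] vanishing_order_attained[OF g w] unfolding m_def l_def by metis
  then obtain u where u: "line_deriv f p m u \<noteq> 0" "line_deriv g p l u \<noteq> 0"
    using common_direction[OF f g \<rho> low] by metis
  have p: "p \<in> ball p \<rho>" using \<rho> by simp
  note lead = line_deriv_mult_leading[OF f g open_ball p low]
  have nz: "line_deriv (\<lambda>z. f z * g z) p (m + l) u \<noteq> 0" using u by (simp add: lead(1))
  show "vanishing_order (\<lambda>z. f z * g z) p = vanishing_order f p + vanishing_order g p"
    unfolding vanishing_order_def[of "\<lambda>z. f z * g z"] m_def[symmetric] l_def[symmetric]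
    using nz lead(2) by (intro Least_equality) (auto simp flip: not_less)
  show "\<exists>z\<in>ball p \<rho>. f z * g z \<noteq> 0"
    using nz line_deriv_cong[OF open_ball p, of "\<lambda>z. f z * g z" "\<lambda>_. 0"] line_deriv_zero_fun by metis
qed

section \<open>Entire functions with prescribed zeros\<close>

text \<open>The quotient is holomorphic away from \<open>z\<close> and agrees with
  \<open>zor_poly\<close> near \<open>z\<close>, which removes the singularity. The point
  \<open>w0\<close> rules out the zero function, so the order is finite.\<close>

lemma entire_divide_zero:
  assumes F: "F holomorphic_on UNIV" and nz: "F w0 \<noteq> 0"
  obtains G where "G holomorphic_on UNIV" "G z \<noteq> 0" "\<And>w. F w = (w - z) ^ nat (zorder F z) * G w"
proof -
  let ?n = "nat (zorder F z)" and ?g = "zor_poly F z"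
  obtain r where r: "r > 0" "?g holomorphic_on cball z r"
      "\<And>w. w \<in> cball z r \<Longrightarrow> F w = ?g w * (w - z) ^ ?n" "\<And>w. w \<in> cball z r \<Longrightarrow> ?g w \<noteq> 0"
    using zorder_exist_zero[OF F open_UNIV connected_UNIV UNIV_I, of z] nz by blast
  define G where "G w = (if w = z then ?g z else F w / (w - z) ^ ?n)" for w
  have eq: "G w = ?g w" if "w \<in> ball z r" for w
    using r(3)[of w] that by (auto simp: G_def)
  have "G holomorphic_on ball z r"
    using holomorphic_on_subset[OF r(2) ball_subset_cball] eq by (metis holomorphic_cong)
  moreover have "(\<lambda>w. F w / (w - z) ^ ?n) holomorphic_on - {z}"
    by (intro holomorphic_intros holomorphic_on_subset[OF F]) auto
  then have "G holomorphic_on - {z}"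
    by (rule holomorphic_transform) (auto simp: G_def)
  ultimately have "G holomorphic_on ball z r \<union> - {z}"
    by (intro holomorphic_on_Un) auto
  moreover have "ball z r \<union> - {z} = UNIV" using r by auto
  ultimately have hol: "G holomorphic_on UNIV" by simp
  show thesis
  proof (rule that[OF hol])
    show "G z \<noteq> 0" using r by (simp add: G_def)
    show "F w = (w - z) ^ ?n * G w" for w
      using r(3)[of z] r(1) by (cases "w = z") (auto simp: G_def)
  qed
qed

text \<open>Weierstrass product over a sequence with repetitions: the order of the product at a
  point is the number of indices mapped to it. The growth bound keeps the points away from 0 and
  sends them to infinity.\<close>

lemma entire_with_prescribed_zeros:
  fixes z :: "nat \<Rightarrow> complex" and n :: "nat \<Rightarrow> nat"
  assumes inj: "inj z" and z: "\<And>k. norm (z k) \<ge> real (Suc k)" and n: "\<And>k. n k \<ge> 1"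
  shows "\<exists>F. F holomorphic_on UNIV \<and>
    (\<forall>k. \<exists>G. G holomorphic_on UNIV \<and> G (z k) \<noteq> 0 \<and> (\<forall>w. F w = (w - z k) ^ n k * G w))"
proof -
  \<comment> \<open>Enumerating \<open>S\<close> lists each \<open>z k\<close> exactly \<open>n k\<close> times.\<close>
  define S where "S = (SIGMA k:UNIV. {..<n k})"
  define e where "e = from_nat_into S"
  \<comment> \<open>Since every \<open>n k\<close> is at least 1, \<open>S\<close> is infinite, so
    that \<open>e\<close> is a bijection from the naturals onto it.\<close>
  have "range (\<lambda>k. (k, 0)) \<subseteq> S" using n by (auto simp: S_def Suc_le_eq)
  moreover have "infinite (range (\<lambda>k::nat. (k, 0::nat)))"
    by (intro range_inj_infinite) (auto simp: inj_def)
  ultimately have "infinite S" using finite_subset by blast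
  then have e: "inj e" "range e = S"
    using bij_betw_from_nat_into[of S] by (auto simp: e_def bij_betw_def)
  define a where "a j = z (fst (e j))" for j
  have fibre: "a -` {z k} = e -` ({k} \<times> {..<n k})" for k
  proof -
    have "e j \<in> S" for j using e by auto
    then show ?thesis using inj
      by (auto simp: a_def S_def inj_eq mem_Times_iff dest: spec split: prod.splits) 
        (metis SigmaE lessThan_iff snd_conv fst_conv)
  qed
  interpret weierstrass_product' a
  proof
    show "a j \<noteq> 0" for j using z[of "fst (e j)"] by (auto simp: a_def)
    show "finite (a -` {w})" if "w \<in> range a" for w
      using that fibre finite_vimageI[OF _ e(1)] by (auto simp: a_def)
    show "filterlim a at_infinity at_top"
      unfolding filterlim_at_infinity[OF order_refl] cofinite_eq_sequentially[symmetric] eventually_cofinite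
    proof safe
      fix r :: real assume "r > 0"
      \<comment> \<open>Only finitely many \<open>k\<close> satisfy \<open>k + 1 < r\<close>, and
        each is listed finitely often.\<close>
      have "{j. \<not> r \<le> norm (a j)} \<subseteq> e -` (SIGMA k:{..nat \<lceil>r\<rceil>}. {..<n k})"
      proof
        fix j assume "j \<in> {j. \<not> r \<le> norm (a j)}"
        then have "real (fst (e j)) < r" using z[of "fst (e j)"] by (simp add: a_def)
        then have "fst (e j) \<le> nat \<lceil>r\<rceil>" by linarith
        moreover have "e j \<in> S" using e by auto
        ultimately show "j \<in> e -` (SIGMA k:{..nat \<lceil>r\<rceil>}. {..<n k})" by (auto simp: S_def)
      qed
      then show "finite {j. \<not> r \<le> norm (a j)}"
        by (rule finite_subset) (intro finite_vimageI e finite_SigmaI; simp)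
    qed
  qed
  have ord: "zorder f (z k) = int (n k)" for k
  proof -
    have "card (e -` ({k} \<times> {..<n k})) = card ({k} \<times> {..<n k})"
      using e by (intro card_vimage_inj) (auto simp: S_def)
    then show ?thesis by (simp add: zorder fibre)
  qed
  have nz: "f 0 \<noteq> 0" using zero[of 0] a_nonzero by auto
  show ?thesis
  proof (rule exI[of _ f], intro conjI allI holomorphic)
    show "\<exists>G. G holomorphic_on UNIV \<and> G (z k) \<noteq> 0 \<and> (\<forall>w. f w = (w - z k) ^ n k * G w)" for k
      using entire_divide_zero[OF holomorphic nz, of "z k"] unfolding ord nat_int by metis
  qed
qed

section \<open>Connected complex manifolds\<close>

locale connected_complex_manifold =
  fixes X :: "'a topology" and \<A> :: "('a set \<times> ('a \<Rightarrow> complex ^ 'n::finite)) set"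
  assumes manifold: "complex_manifold X \<A>" and connected: "connected_space X"
begin

section \<open>Working with charts\<close>

lemma chart_cover: "x \<in> topspace X \<Longrightarrow> \<exists>U \<phi>. (U, \<phi>) \<in> \<A> \<and> x \<in> U"
  using manifold unfolding complex_manifold_def by blast

context
  fixes U \<phi> assumes chart: "(U, \<phi>) \<in> \<A>"
begin

lemma chart_openin: "openin X U" and chart_open: "open (\<phi> ` U)"
  and chart_homeomorphic: "homeomorphic_map (subtopology X U) (top_of_set (\<phi> ` U)) \<phi>"
  using manifold chart unfolding complex_manifold_def by auto

lemma chart_subset: "U \<subseteq> topspace X"
  using chart_openin by (rule openin_subset)

lemma chart_inj: "inj_on \<phi> U"
  using chart_homeomorphic chart_subset
  by (auto simp: homeomorphic_eq_everything_map Int_absorb1)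

lemma chart_inv: "x \<in> U \<Longrightarrow> inv_into U \<phi> (\<phi> x) = x"
  using chart_inj by simp

lemma chart_openin_preimage:
  assumes "open T"
  shows "openin X {x \<in> U. \<phi> x \<in> T}"
proof -
  have "continuous_map (subtopology X U) euclidean \<phi>"
    using chart_homeomorphic homeomorphic_imp_continuous_map continuous_map_into_fulltopology by blast
  then have "openin (subtopology X U) {x \<in> topspace (subtopology X U). \<phi> x \<in> T}"
    using assms by (intro openin_continuous_map_preimage) auto
  moreover have "topspace (subtopology X U) = U" using chart_subset by auto
  ultimately show ?thesis using chart_openin openin_trans_full by metis
qed

lemma chart_open_image:
  assumes "openin X W" "W \<subseteq> U"
  shows "open (\<phi> ` W)"
proof -
  have "openin (subtopology X U) W"
    using assms by (metis openin_subtopology_Int inf.absorb_iff1)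
  then have "openin (top_of_set (\<phi> ` U)) (\<phi> ` W)"
    using chart_homeomorphic homeomorphic_imp_open_map open_map_def by blast
  then show ?thesis using chart_open openin_open_trans by blast
qed

lemma holomorphic_fun_chart: "holomorphic_fun X \<A> f \<Longrightarrow> holomorphic_Cn (f \<circ> inv_into U \<phi>) (\<phi> ` U)"
  using chart unfolding holomorphic_fun_def by blast

end

section \<open>Closure properties of holomorphic functions on the manifold\<close>

lemma holomorphic_funI:
  assumes "\<And>U \<phi>. (U, \<phi>) \<in> \<A> \<Longrightarrow> holomorphic_Cn (\<lambda>z. f (inv_into U \<phi> z)) (\<phi> ` U)"
  shows "holomorphic_fun X \<A> f"
  using assms unfolding holomorphic_fun_def by (auto simp: comp_def)

lemma holomorphic_fun_cong:
  assumes "\<And>x. x \<in> topspace X \<Longrightarrow> f x = g x" "holomorphic_fun X \<A> f"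
  shows "holomorphic_fun X \<A> g"
  unfolding holomorphic_fun_def
proof clarify
  fix U \<phi> assume c: "(U, \<phi>) \<in> \<A>"
  show "holomorphic_Cn (g \<circ> inv_into U \<phi>) (\<phi> ` U)"
    by (rule holomorphic_Cn_cong[OF chart_open[OF c] _ holomorphic_fun_chart[OF c assms(2)]])
      (use chart_subset[OF c] chart_inv[OF c] assms(1) in auto)
qed

lemma holomorphic_fun_const: "holomorphic_fun X \<A> (\<lambda>_. c)"
  by (intro holomorphic_funI holomorphic_Cn_const)

lemma holomorphic_fun_add:
  assumes "holomorphic_fun X \<A> f" "holomorphic_fun X \<A> g"
  shows "holomorphic_fun X \<A> (\<lambda>x. f x + g x)"
  using assms[THEN holomorphic_fun_chart[rotated]]
  by (intro holomorphic_funI holomorphic_Cn_add) (auto simp: comp_def)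

lemma holomorphic_fun_mult:
  assumes "holomorphic_fun X \<A> f" "holomorphic_fun X \<A> g"
  shows "holomorphic_fun X \<A> (\<lambda>x. f x * g x)"
  using assms[THEN holomorphic_fun_chart[rotated]]
  by (intro holomorphic_funI holomorphic_Cn_mult) (auto simp: comp_def)

lemma holomorphic_fun_compose:
  assumes "holomorphic_fun X \<A> f" "g holomorphic_on T" "open T" "f ` topspace X \<subseteq> T"
  shows "holomorphic_fun X \<A> (\<lambda>x. g (f x))"
proof (rule holomorphic_funI)
  fix U \<phi> assume c: "(U, \<phi>) \<in> \<A>"
  show "holomorphic_Cn (\<lambda>z. g (f (inv_into U \<phi> z))) (\<phi> ` U)"
    by (rule holomorphic_Cn_compose[OF _ assms(2,3)])
      (use holomorphic_fun_chart[OF c assms(1)] assms(4) chart_subset[OF c] chart_inv[OF c]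
        in \<open>auto simp: comp_def image_subset_iff subset_iff\<close>)
qed

lemma holomorphic_fun_diff:
  assumes "holomorphic_fun X \<A> f" "holomorphic_fun X \<A> g"
  shows "holomorphic_fun X \<A> (\<lambda>x. f x - g x)"
  using holomorphic_fun_add[OF assms(1) holomorphic_fun_mult[OF holomorphic_fun_const[of "- 1"] assms(2)]]
  by simp

lemma holomorphic_fun_power: "holomorphic_fun X \<A> f \<Longrightarrow> holomorphic_fun X \<A> (\<lambda>x. f x ^ n)"
  by (induction n) (auto intro: holomorphic_fun_const holomorphic_fun_mult)

text \<open>The interior \<open>Z\<close> of the zero set is open and, by the identity theorem in
  chart balls, also closed. Being nonempty, it is the whole connected space.\<close>

lemma holomorphic_fun_eq_0:
  assumes f: "holomorphic_fun X \<A> f" and W: "openin X W" "W \<noteq> {}" "\<And>y. y \<in> W \<Longrightarrow> f y = 0"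
    and x: "x \<in> topspace X"
  shows "f x = 0"
proof -
  define Z where "Z = \<Union>{W. openin X W \<and> (\<forall>y\<in>W. f y = 0)}"
  have Z: "openin X Z"
    unfolding Z_def by (rule openin_Union) blast
  note Z
  moreover have "openin X (topspace X - Z)"
  proof (subst openin_subopen, rule ballI)
    fix x assume x: "x \<in> topspace X - Z"
    then obtain U \<phi> where c: "(U, \<phi>) \<in> \<A>" "x \<in> U" using chart_cover by blast
    then obtain r where r: "r > 0" "ball (\<phi> x) r \<subseteq> \<phi> ` U"
      using chart_open[OF c(1)] by (meson imageI open_contains_ball)
    define N where "N = {y \<in> U. \<phi> y \<in> ball (\<phi> x) r}"
    have N: "openin X N" "x \<in> N" "N \<subseteq> U" "N \<subseteq> topspace X"
      unfolding N_def using chart_subset[OF c(1)] c r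
      by (auto intro: chart_openin_preimage[OF c(1) open_ball, simplified])
    \<comment> \<open>If the chart ball \<open>N\<close> around \<open>x\<close> met
      \<open>Z\<close>, then \<open>f\<close> would vanish on an open part of \<open>N\<close>,
      hence on all of \<open>N\<close>, putting \<open>x\<close> into \<open>Z\<close>.\<close>
    have "N \<inter> Z = {}"
    proof (rule ccontr)
      assume "N \<inter> Z \<noteq> {}"
      then obtain y V where y: "y \<in> N" "openin X V" "y \<in> V" "\<forall>y\<in>V. f y = 0" unfolding Z_def by blast
      have "f w = 0" if "w \<in> N" for w
      proof -
        have "(f \<circ> inv_into U \<phi>) (\<phi> w) = 0"
        proof (rule holomorphic_Cn_eq_0[where S = "ball (\<phi> x) r" and T = "\<phi> ` (V \<inter> N)" and q = "\<phi> y"])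
          show "holomorphic_Cn (f \<circ> inv_into U \<phi>) (ball (\<phi> x) r)"
            using holomorphic_fun_chart[OF c(1) f] r(2) by (rule holomorphic_Cn_subset)
          show "open (\<phi> ` (V \<inter> N))"
            using chart_open_image[OF c(1)] y N by (meson openin_Int le_infI2)
        qed (use y that N chart_inv[OF c(1)] in \<open>auto simp: N_def\<close>)
        then show ?thesis using that N chart_inv[OF c(1)] by auto
      qed
      then have "x \<in> Z" using N x unfolding Z_def by blast
      then show False using x by blast
    qed
    then show "\<exists>T. openin X T \<and> x \<in> T \<and> T \<subseteq> topspace X - Z" using N by blast
  qed
  moreover have "Z \<noteq> {}" using W unfolding Z_def by blast
  moreover have "Z \<subseteq> topspace X" using Z by (rule openin_subset)
  ultimately have "topspace X - Z = {}"
    using connected unfolding connected_space_def by blast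
  with x show ?thesis unfolding Z_def by blast
qed

text \<open>A chart ball around the maximum point gives local constancy; the identity theorem
  applied to \<open>f - f x\<close> spreads it over the connected space.\<close>

lemma maximum_modulus:
  assumes f: "holomorphic_fun X \<A> f" and x: "x \<in> topspace X"
    and max: "\<And>y. y \<in> topspace X \<Longrightarrow> norm (f y) \<le> norm (f x)"
  shows "f constant_on topspace X"
proof -
  obtain U \<phi> where c: "(U, \<phi>) \<in> \<A>" "x \<in> U" using chart_cover x by blast
  then obtain r where r: "r > 0" "ball (\<phi> x) r \<subseteq> \<phi> ` U"
    using chart_open[OF c(1)] by (meson imageI open_contains_ball)
  define N where "N = {y \<in> U. \<phi> y \<in> ball (\<phi> x) r}"
  have "f y - f x = 0" if "y \<in> topspace X" for y
  proof (rule holomorphic_fun_eq_0[where f = "\<lambda>y. f y - f x" and W = N])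
    show "holomorphic_fun X \<A> (\<lambda>y. f y - f x)"
      by (intro holomorphic_fun_diff f holomorphic_fun_const)
    show "openin X N" unfolding N_def by (rule chart_openin_preimage[OF c(1) open_ball])
    show "N \<noteq> {}" using c r by (auto simp: N_def)
    fix y assume y: "y \<in> N"
    have "(f \<circ> inv_into U \<phi>) (\<phi> y) = (f \<circ> inv_into U \<phi>) (\<phi> x)"
    proof (rule holomorphic_Cn_maximum_modulus[OF _ open_ball convex_ball])
      show "holomorphic_Cn (f \<circ> inv_into U \<phi>) (ball (\<phi> x) r)"
        using holomorphic_fun_chart[OF c(1) f] r(2) by (rule holomorphic_Cn_subset)
      fix z assume "z \<in> ball (\<phi> x) r"
      then obtain y where "y \<in> U" "z = \<phi> y" using r by blast
      then show "norm ((f \<circ> inv_into U \<phi>) z) \<le> norm ((f \<circ> inv_into U \<phi>) (\<phi> x))"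
        using max chart_inv[OF c(1)] c chart_subset[OF c(1)] by auto
    qed (use y r in \<open>auto simp: N_def\<close>)
    then show "f y - f x = 0" using y c chart_inv[OF c(1)] by (auto simp: N_def)
  qed fact
  then show ?thesis unfolding constant_on_def by (metis eq_iff_diff_eq_0)
qed

lemma unbounded_holomorphic_fun_exists:
  assumes h: "holomorphic_fun X \<A> h" and nc: "\<not> h constant_on topspace X"
  shows "\<exists>H. holomorphic_fun X \<A> H \<and> (\<forall>R. \<exists>x\<in>topspace X. norm (H x) > R)"
proof (cases "bounded (h ` topspace X)")
  case False
  then show ?thesis using h unfolding bounded_iff by (metis imageE not_le)
next
  case True
  have ne: "topspace X \<noteq> {}" using nc by (auto simp: constant_on_def)
  have "\<not> closed (h ` topspace X)"
  proof
    assume "closed (h ` topspace X)"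
    then have "compact (h ` topspace X)" using True compact_eq_bounded_closed by blast
    then obtain x where "x \<in> topspace X" "\<And>y. y \<in> topspace X \<Longrightarrow> norm (h y) \<le> norm (h x)"
      using continuous_attains_sup[of "h ` topspace X" norm] ne
      by (auto intro: continuous_intros)
    with maximum_modulus[OF h] nc show False by blast
  qed
  then obtain z where z: "z \<in> closure (h ` topspace X)" "z \<notin> h ` topspace X"
    using closure_subset closure_eq by (metis subsetI subset_antisym)
  \<comment> \<open>Since \<open>z\<close> is not a value of \<open>h\<close>, the image of
    \<open>h\<close> lies in the open set \<open>- {z}\<close>, where the reciprocal is
    holomorphic.\<close>
  have "holomorphic_fun X \<A> (\<lambda>x. (\<lambda>w. 1 / (w - z)) (h x))"
    by (rule holomorphic_fun_compose[OF h, of _ "- {z}"]) (use z in \<open>auto intro!: holomorphic_intros\<close>)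
  moreover have "\<exists>x\<in>topspace X. norm (1 / (h x - z)) > R" for R
  proof -
    have "1 / (\<bar>R\<bar> + 1) > 0" by simp
    then obtain x where x: "x \<in> topspace X" "norm (h x - z) < 1 / (\<bar>R\<bar> + 1)"
      using z(1) unfolding closure_approachable dist_norm by blast
    moreover have "norm (h x - z) > 0" using x z by auto
    ultimately have "\<bar>R\<bar> + 1 < norm (1 / (h x - z))" by (simp add: norm_divide field_simps)
    with x show ?thesis by (intro bexI[of _ x]) auto
  qed
  ultimately show ?thesis by blast
qed

text \<open>
  One chart per point is fixed by choice, so that the independence of the order of vanishing from
  the chart plays no role.
\<close>

definition local_chart :: "'a \<Rightarrow> 'a set \<times> ('a \<Rightarrow> complex ^ 'n)" where
  "local_chart x = (SOME c. c \<in> \<A> \<and> x \<in> fst c)"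

definition local_point :: "'a \<Rightarrow> complex ^ 'n" where
  "local_point x = snd (local_chart x) x"

definition local_radius :: "'a \<Rightarrow> real" where
  "local_radius x = (SOME r. r > 0 \<and> ball (local_point x) r \<subseteq> snd (local_chart x) ` fst (local_chart x))"

abbreviation local_ball :: "'a \<Rightarrow> (complex ^ 'n) set" where
  "local_ball x \<equiv> ball (local_point x) (local_radius x)"

text \<open>The representation of \<open>f\<close> in the chosen chart. It is significant only on
  the image of the chart, in particular on \<open>local_ball x\<close>; outside that image
  \<open>inv_into\<close> is arbitrary.\<close>

definition local_rep :: "'a \<Rightarrow> ('a \<Rightarrow> complex) \<Rightarrow> complex ^ 'n \<Rightarrow> complex" where
  "local_rep x f z = f (inv_into (fst (local_chart x)) (snd (local_chart x)) z)"

context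
  fixes x assumes x: "x \<in> topspace X"
begin

lemma local_chart: "(fst (local_chart x), snd (local_chart x)) \<in> \<A>" "x \<in> fst (local_chart x)"
proof -
  have "\<exists>c. c \<in> \<A> \<and> x \<in> fst c" using chart_cover[OF x] by force
  from someI_ex[OF this] show "(fst (local_chart x), snd (local_chart x)) \<in> \<A>" "x \<in> fst (local_chart x)"
    by (auto simp: local_chart_def)
qed

lemma local_radius:
  shows "local_radius x > 0" and "local_ball x \<subseteq> snd (local_chart x) ` fst (local_chart x)"
proof -
  have "\<exists>r>0. ball (local_point x) r \<subseteq> snd (local_chart x) ` fst (local_chart x)"
    using chart_open[OF local_chart(1)] local_chart(2) unfolding local_point_def
    by (meson imageI open_contains_ball)
  from someI_ex[OF this] show "local_radius x > 0"
    and "local_ball x \<subseteq> snd (local_chart x) ` fst (local_chart x)"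
    by (auto simp: local_radius_def)
qed

lemma local_rep_point: "local_rep x f (local_point x) = f x"
  by (simp add: local_rep_def local_point_def chart_inv[OF local_chart(1)] local_chart(2))

lemma local_rep_eq:
  assumes "z \<in> local_ball x"
  obtains y where "y \<in> topspace X" "\<And>f. local_rep x f z = f y"
proof
  have "z \<in> snd (local_chart x) ` fst (local_chart x)" using assms local_radius(2) by blast
  from subsetD[OF chart_subset[OF local_chart(1)] inv_into_into[OF this]]
  show "inv_into (fst (local_chart x)) (snd (local_chart x)) z \<in> topspace X" .
qed (rule local_rep_def)

lemma holomorphic_Cn_local_rep:
  assumes "holomorphic_fun X \<A> f"
  shows "holomorphic_Cn (local_rep x f) (local_ball x)"
  using holomorphic_Cn_subset[OF holomorphic_fun_chart[OF local_chart(1) assms] local_radius(2)]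
  by (simp add: local_rep_def[abs_def] comp_def)

text \<open>Connectedness enters the valuations here: by the identity theorem a function that is
  nonzero at one point \<open>y\<close>, however far from \<open>x\<close>, is not identically zero
  in the chart ball at \<open>x\<close>.\<close>

lemma local_rep_nonzero:
  assumes f: "holomorphic_fun X \<A> f" and y: "y \<in> topspace X" "f y \<noteq> 0"
  obtains z where "z \<in> local_ball x" "local_rep x f z \<noteq> 0"
proof (rule ccontr)
  assume "\<not> thesis"
  with that have *: "local_rep x f z = 0" if "z \<in> local_ball x" for z
    using \<open>z \<in> local_ball x\<close> by blast
  note open_set = chart_openin_preimage[OF local_chart(1) open_ball[of "local_point x" "local_radius x"]]
  have "f y = 0"
  proof (rule holomorphic_fun_eq_0[OF f open_set])
    show "{y \<in> fst (local_chart x). snd (local_chart x) y \<in> local_ball x} \<noteq> {}"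
      using local_chart(2) local_radius(1) by (auto simp: local_point_def)
    fix w assume "w \<in> {y \<in> fst (local_chart x). snd (local_chart x) y \<in> local_ball x}"
    then show "f w = 0"
      using *[of "snd (local_chart x) w"] chart_inv[OF local_chart(1), of w] by (simp add: local_rep_def)
  qed fact
  with y show False by blast
qed

end

section \<open>Order of vanishing at a point of the manifold\<close>

definition order_at :: "('a \<Rightarrow> complex) \<Rightarrow> 'a \<Rightarrow> nat" where
  "order_at f x = vanishing_order (local_rep x f) (local_point x)"

lemma order_at_cong:
  assumes "x \<in> topspace X" "\<And>y. y \<in> topspace X \<Longrightarrow> f y = g y"
  shows "order_at f x = order_at g x"
  unfolding order_at_def
proof (rule vanishing_order_cong[OF open_ball])
  show "local_point x \<in> local_ball x" using local_radius(1)[OF assms(1)] by simp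
  show "local_rep x f z = local_rep x g z" if "z \<in> local_ball x" for z
    using assms(2) local_rep_eq[OF assms(1) that] by metis
qed

lemma order_at_add:
  assumes f: "holomorphic_fun X \<A> f" and g: "holomorphic_fun X \<A> g"
    and x: "x \<in> topspace X" and nz: "y \<in> topspace X" "f y + g y \<noteq> 0"
  shows "min (order_at f x) (order_at g x) \<le> order_at (\<lambda>y. f y + g y) x"
proof -
  have rep: "local_rep x (\<lambda>y. f y + g y) = (\<lambda>z. local_rep x f z + local_rep x g z)"
    by (simp add: local_rep_def fun_eq_iff)
  obtain z where "z \<in> local_ball x" "local_rep x f z + local_rep x g z \<noteq> 0"
    using local_rep_nonzero[OF x holomorphic_fun_add[OF f g] nz] unfolding rep by blast
  from vanishing_order_add[OF holomorphic_Cn_local_rep[OF x f] holomorphic_Cn_local_rep[OF x g] this]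
  show ?thesis unfolding order_at_def rep .
qed

lemma order_at_mult:
  assumes f: "holomorphic_fun X \<A> f" and g: "holomorphic_fun X \<A> g" and x: "x \<in> topspace X"
    and y: "y \<in> topspace X" "f y \<noteq> 0" and w: "w \<in> topspace X" "g w \<noteq> 0"
  shows "order_at (\<lambda>y. f y * g y) x = order_at f x + order_at g x"
    and "\<exists>y\<in>topspace X. f y * g y \<noteq> 0"
proof -
  have rep: "local_rep x (\<lambda>y. f y * g y) = (\<lambda>z. local_rep x f z * local_rep x g z)"
    by (simp add: local_rep_def fun_eq_iff)
  obtain a b where ab: "a \<in> local_ball x" "local_rep x f a \<noteq> 0" "b \<in> local_ball x" "local_rep x g b \<noteq> 0"
    using local_rep_nonzero[OF x f y] local_rep_nonzero[OF x g w] by metis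
  note vo = vanishing_order_mult[OF holomorphic_Cn_local_rep[OF x f] holomorphic_Cn_local_rep[OF x g] ab]
  show "order_at (\<lambda>y. f y * g y) x = order_at f x + order_at g x"
    unfolding order_at_def rep by (rule vo(1))
  show "\<exists>y\<in>topspace X. f y * g y \<noteq> 0"
    using vo(2) local_rep_eq[OF x] by metis
qed

lemma order_at_eq_0: "x \<in> topspace X \<Longrightarrow> f x \<noteq> 0 \<Longrightarrow> order_at f x = 0"
  by (simp add: order_at_def local_rep_point vanishing_order_eq_0)

lemma order_at_power:
  assumes f: "holomorphic_fun X \<A> f" and x: "x \<in> topspace X" and y: "y \<in> topspace X" "f y \<noteq> 0"
  shows "order_at (\<lambda>y. f y ^ n) x = n * order_at f x"
proof (induction n)
  case 0
  show ?case by (simp add: order_at_eq_0 x)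
next
  case (Suc n)
  show ?case
    using order_at_mult(1)[OF f holomorphic_fun_power[OF f] x y, of y n] y Suc by simp
qed

lemma order_at_pos:
  assumes f: "holomorphic_fun X \<A> f" and x: "x \<in> topspace X" "f x = 0"
    and y: "y \<in> topspace X" "f y \<noteq> 0"
  shows "order_at f x > 0"
proof -
  obtain z where z: "z \<in> local_ball x" "local_rep x f z \<noteq> 0"
    using local_rep_nonzero[OF x(1) f y] .
  from vanishing_order_pos[OF holomorphic_Cn_local_rep[OF x(1) f] z] show ?thesis
    by (simp add: order_at_def local_rep_point x)
qed

section \<open>The ring of holomorphic functions\<close>

lemma carrier_holomorphic_ring:
  "f \<in> carrier (holomorphic_ring X \<A>) \<longleftrightarrow> f \<in> extensional (topspace X) \<and> holomorphic_fun X \<A> f"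
  by (simp add: holomorphic_ring_def)

lemma holomorphic_ring_simps:
  "f \<oplus>\<^bsub>holomorphic_ring X \<A>\<^esub> g = (\<lambda>x\<in>topspace X. f x + g x)"
  "f \<otimes>\<^bsub>holomorphic_ring X \<A>\<^esub> g = (\<lambda>x\<in>topspace X. f x * g x)"
  "\<zero>\<^bsub>holomorphic_ring X \<A>\<^esub> = (\<lambda>x\<in>topspace X. 0)"
  "\<one>\<^bsub>holomorphic_ring X \<A>\<^esub> = (\<lambda>x\<in>topspace X. 1)"
  by (simp_all add: holomorphic_ring_def)

lemma restrict_in_carrier:
  assumes "holomorphic_fun X \<A> f"
  shows "(\<lambda>x\<in>topspace X. f x) \<in> carrier (holomorphic_ring X \<A>)"
  unfolding carrier_holomorphic_ring using holomorphic_fun_cong[OF _ assms] by simp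

lemma cring_holomorphic_ring: "cring (holomorphic_ring X \<A>)"
proof (intro cringI abelian_groupI comm_monoidI)
  fix f assume f: "f \<in> carrier (holomorphic_ring X \<A>)"
  then have "holomorphic_fun X \<A> (\<lambda>x. 0 - f x)"
    by (intro holomorphic_fun_diff holomorphic_fun_const) (simp add: carrier_holomorphic_ring)
  from restrict_in_carrier[OF this]
  show "\<exists>g\<in>carrier (holomorphic_ring X \<A>). g \<oplus>\<^bsub>holomorphic_ring X \<A>\<^esub> f = \<zero>\<^bsub>holomorphic_ring X \<A>\<^esub>"
    by (intro bexI) (auto simp: holomorphic_ring_simps fun_eq_iff)
qed (auto simp: holomorphic_ring_simps carrier_holomorphic_ring fun_eq_iff extensional_def algebra_simps
      intro: restrict_in_carrier[unfolded carrier_holomorphic_ring, THEN conjunct2] holomorphic_fun_const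
        holomorphic_fun_add holomorphic_fun_mult)

text \<open>Zero is tested on \<open>topspace X\<close> only, so the definition also makes sense for
  functions that are not extensional. The divisor \<open>d\<close> will be the order of
  \<open>H - z k\<close>, to make every positive integer a value.\<close>

definition scaled_order :: "'a \<Rightarrow> real \<Rightarrow> ('a \<Rightarrow> complex) \<Rightarrow> ennreal" where
  "scaled_order x d f = (if \<forall>y\<in>topspace X. f y = 0 then \<infinity> else ennreal (order_at f x / d))"

lemma scaled_order_cong:
  assumes "x \<in> topspace X" "\<And>y. y \<in> topspace X \<Longrightarrow> f y = g y"
  shows "scaled_order x d f = scaled_order x d g"
  using order_at_cong[of x f g] assms by (simp add: scaled_order_def)

lemma valuation_scaled_order:
  assumes x: "x \<in> topspace X" and d: "d > 0"
  shows "valuation (holomorphic_ring X \<A>) (scaled_order x d)"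
  unfolding valuation_def
proof (intro conjI ballI)
  fix f g assume "f \<in> carrier (holomorphic_ring X \<A>)" "g \<in> carrier (holomorphic_ring X \<A>)"
  then have f: "holomorphic_fun X \<A> f" and g: "holomorphic_fun X \<A> g"
    by (auto simp: carrier_holomorphic_ring)
  show "min (scaled_order x d f) (scaled_order x d g) \<le> scaled_order x d (f \<oplus>\<^bsub>holomorphic_ring X \<A>\<^esub> g)"
  proof -
    have sum: "scaled_order x d (f \<oplus>\<^bsub>holomorphic_ring X \<A>\<^esub> g) = scaled_order x d (\<lambda>y. f y + g y)"
      by (rule scaled_order_cong[OF x]) (simp add: holomorphic_ring_simps)
    \<comment> \<open>The first three cases collect the infinite values; in the last one all three
      orders are finite and meaningful.\<close>
    consider "\<forall>y\<in>topspace X. f y = 0" | "\<forall>y\<in>topspace X. g y = 0"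
      | "\<forall>y\<in>topspace X. f y + g y = 0"
      | (nz) y where "\<not> (\<forall>y\<in>topspace X. f y = 0)" "\<not> (\<forall>y\<in>topspace X. g y = 0)"
        "y \<in> topspace X" "f y + g y \<noteq> 0"
      by blast
    then show ?thesis
    proof cases
      case 1
      then have "scaled_order x d (\<lambda>y. f y + g y) = scaled_order x d g"
        by (intro scaled_order_cong[OF x]) simp
      then show ?thesis unfolding sum by simp
    next
      case 2
      then have "scaled_order x d (\<lambda>y. f y + g y) = scaled_order x d f"
        by (intro scaled_order_cong[OF x]) simp
      then show ?thesis unfolding sum by simp
    next
      case 3
      then have "scaled_order x d (\<lambda>y. f y + g y) = \<infinity>" by (simp add: scaled_order_def)
      then show ?thesis unfolding sum by simp
    next
      case nz
      from order_at_add[OF f g x nz(3,4)]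
      have "order_at f x / d \<le> order_at (\<lambda>y. f y + g y) x / d
          \<or> order_at g x / d \<le> order_at (\<lambda>y. f y + g y) x / d"
        using d by (simp add: min_le_iff_disj divide_le_cancel)
      then have "min (ennreal (order_at f x / d)) (ennreal (order_at g x / d))
          \<le> ennreal (order_at (\<lambda>y. f y + g y) x / d)"
        using ennreal_leI unfolding min_le_iff_disj by blast
      moreover have "\<not> (\<forall>y\<in>topspace X. f y + g y = 0)" using nz(3,4) by blast
      ultimately show ?thesis
        unfolding sum unfolding scaled_order_def using nz(1,2) by (simp only: if_False)
    qed
  qed
  show "scaled_order x d (f \<otimes>\<^bsub>holomorphic_ring X \<A>\<^esub> g) = scaled_order x d f + scaled_order x d g"
  proof (cases "(\<forall>y\<in>topspace X. f y = 0) \<or> (\<forall>y\<in>topspace X. g y = 0)")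
    case True
    then show ?thesis by (auto simp: scaled_order_def holomorphic_ring_simps)
  next
    case False
    then obtain y w where yw: "y \<in> topspace X" "f y \<noteq> 0" "w \<in> topspace X" "g w \<noteq> 0" by blast
    note mult = order_at_mult[OF f g x yw]
    have ord: "order_at (\<lambda>y\<in>topspace X. f y * g y) x = order_at f x + order_at g x"
      unfolding mult(1)[symmetric] by (rule order_at_cong[OF x]) simp
    \<comment> \<open>By \<open>mult(2)\<close> the product of two nonzero functions is nonzero, so
      its value is finite.\<close>
    have "scaled_order x d (f \<otimes>\<^bsub>holomorphic_ring X \<A>\<^esub> g) = ennreal ((order_at f x + order_at g x) / d)"
      using mult(2) by (auto simp: scaled_order_def holomorphic_ring_simps ord)
    also have "\<dots> = ennreal (order_at f x / d) + ennreal (order_at g x / d)"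
      using d by (subst ennreal_plus[symmetric]) (auto simp: add_divide_distrib)
    also have "\<dots> = scaled_order x d f + scaled_order x d g"
      using yw by (auto simp: scaled_order_def)
    finally show ?thesis .
  qed
next
  fix f assume "f \<in> carrier (holomorphic_ring X \<A>)"
  \<comment> \<open>Extensionality turns vanishing on \<open>topspace X\<close> into equality with
    the zero of the ring.\<close>
  then have "f \<in> extensional (topspace X)" by (simp add: carrier_holomorphic_ring)
  then have "(\<forall>y\<in>topspace X. f y = 0) \<longleftrightarrow> f = \<zero>\<^bsub>holomorphic_ring X \<A>\<^esub>"
    by (auto simp: holomorphic_ring_simps fun_eq_iff extensional_def)
  then show "scaled_order x d f = \<infinity> \<longleftrightarrow> f = \<zero>\<^bsub>holomorphic_ring X \<A>\<^esub>"
    by (simp add: scaled_order_def)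
next
  have "order_at (\<lambda>x\<in>topspace X. 1) x = 0" using x by (intro order_at_eq_0) auto
  then show "scaled_order x d \<one>\<^bsub>holomorphic_ring X \<A>\<^esub> = 0"
    using x by (auto simp: scaled_order_def holomorphic_ring_simps)
qed

end

section \<open>Choice of points and valuations, and realization of a given hypernatural\<close>

theorem corollary19:
  fixes \<omega> :: "nat filter"
    and X :: "'a topology"
    and \<A> :: "('a set \<times> ('a \<Rightarrow> complex ^ 'n::finite)) set"
    and h :: "'a \<Rightarrow> complex"
  assumes "nonprincipal_ultrafilter \<omega>"
    and "complex_manifold X \<A>"
    and "connected_space X"
    and "holomorphic_fun X \<A> h"
    and "\<not> h constant_on topspace X"
  shows "ample \<omega> (holomorphic_ring X \<A>)"
proof -
  interpret connected_complex_manifold X \<A>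
    using assms by unfold_locales
  obtain H where H: "holomorphic_fun X \<A> H" and unb: "\<And>R. \<exists>x\<in>topspace X. norm (H x) > R"
    using unbounded_holomorphic_fun_exists[OF assms(4,5)] by blast
  \<comment> \<open>Jumps of at least 1 from a start of at least 1 give both distinct values
    \<open>z k\<close> and the growth \<open>k + 1\<close> required by the Weierstrass
    product.\<close>
  have "\<exists>p. \<forall>k. (p k \<in> topspace X \<and> norm (H (p k)) \<ge> 1) \<and> norm (H (p k)) + 1 \<le> norm (H (p (Suc k)))"
  proof (rule dependent_nat_choice)
    show "\<exists>x. x \<in> topspace X \<and> norm (H x) \<ge> 1"
      using unb[of 1] less_imp_le by blast
    show "\<exists>y. (y \<in> topspace X \<and> 1 \<le> norm (H y)) \<and> norm (H x) + 1 \<le> norm (H y)"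
      if "x \<in> topspace X \<and> 1 \<le> norm (H x)" for x and k :: nat
    proof -
      obtain y where "y \<in> topspace X" "norm (H x) + 1 < norm (H y)" using unb by blast
      then show ?thesis using that by (intro exI[of _ y]) auto
    qed
  qed
  then obtain p where p: "\<And>k. p k \<in> topspace X" "\<And>k. norm (H (p k)) \<ge> 1"
      "\<And>k. norm (H (p k)) + 1 \<le> norm (H (p (Suc k)))"
    by blast
  define z where "z k = H (p k)" for k
  have "norm (z k) < norm (z (Suc k))" for k using p(3)[of k] by (simp add: z_def)
  then have "strict_mono (\<lambda>k. norm (z k))" by (simp add: strict_mono_Suc_iff)
  then have inj: "inj z" by (metis injI strict_mono_eq)
  have z_ge: "norm (z k) \<ge> real (Suc k)" for k
  proof (induction k)
    case 0 then show ?case using p(2)[of 0] by (simp add: z_def)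
  next
    case (Suc k) then show ?case using p(3)[of k] by (simp add: z_def)
  qed
  have Hz: "holomorphic_fun X \<A> (\<lambda>x. H x - z k)" for k
    by (intro holomorphic_fun_diff H holomorphic_fun_const)
  \<comment> \<open>\<open>H\<close> exceeds the modulus of \<open>z k\<close> somewhere, so
    \<open>H - z k\<close> is not the zero function and its order at \<open>p k\<close> is
    meaningful.\<close>
  have nz: "\<exists>y\<in>topspace X. H y - z k \<noteq> 0" for k
    using unb[of "norm (z k)"] by force
  \<comment> \<open>\<open>d k\<close> may exceed 1, as \<open>H\<close> may be ramified at \<open>p k\<close>.\<close>
  define d where "d k = order_at (\<lambda>x. H x - z k) (p k)" for k
  have d: "d k > 0" for k
    unfolding d_def using nz[of k] order_at_pos[OF Hz p(1), of k k] by (auto simp: z_def)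
  define \<nu> where "\<nu> k = scaled_order (p k) (d k)" for k
  have "\<forall>k\<ge>1. valuation (holomorphic_ring X \<A>) (\<nu> k)"
    unfolding \<nu>_def using valuation_scaled_order[OF p(1)] d by simp
  moreover have "\<exists>a \<in> carrier (holomorphic_ring X \<A>). ultra_class \<omega> (\<lambda>k. \<nu> k a) = \<beta>"
    if hyper: "\<beta> \<in> hypernat \<omega>" for \<beta>
  proof -
    obtain n where n: "\<And>k. n k \<ge> 1" and \<beta>: "\<beta> = ultra_class \<omega> (\<lambda>k. of_nat (n k))"
      using hyper unfolding hypernat_def by blast
    obtain F where F: "F holomorphic_on UNIV"
      and fac: "\<And>k. \<exists>G. G holomorphic_on UNIV \<and> G (z k) \<noteq> 0 \<and> (\<forall>w. F w = (w - z k) ^ n k * G w)"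
      using entire_with_prescribed_zeros[OF inj z_ge, of n] n by auto
    define a where "a = (\<lambda>x\<in>topspace X. F (H x))"
    \<comment> \<open>Near \<open>p k\<close> as everywhere, \<open>F (H x)\<close> is
      \<open>(H x - z k) ^ n k\<close> times \<open>G (H x)\<close>. The second factor is nonzero at
      \<open>p k\<close>, so the order is \<open>n k * d k\<close>, and the scaling removes
      \<open>d k\<close>.\<close>
    have "\<nu> k a = of_nat (n k)" for k
    proof -
      obtain G where G: "G holomorphic_on UNIV" "G (z k) \<noteq> 0" "\<And>w. F w = (w - z k) ^ n k * G w"
        using fac by blast
      have Gp: "G (H (p k)) \<noteq> 0" using G(2) by (simp add: z_def)
      have GH: "holomorphic_fun X \<A> (\<lambda>x. G (H x))"
        by (rule holomorphic_fun_compose[OF H G(1)]) auto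
      obtain y where y: "y \<in> topspace X" "H y - z k \<noteq> 0" using nz by blast
      then have yn: "(H y - z k) ^ n k \<noteq> 0" by simp
      note mult = order_at_mult[OF holomorphic_fun_power[OF Hz] GH p(1) y(1) yn p(1) Gp]
      have "order_at a (p k) = order_at (\<lambda>x. (H x - z k) ^ n k * G (H x)) (p k)"
        by (rule order_at_cong[OF p(1)]) (simp add: a_def G(3))
      also have "\<dots> = n k * d k"
        unfolding mult(1) order_at_power[OF Hz p(1) y] d_def
        using order_at_eq_0[OF p(1), of "\<lambda>x. G (H x)"] Gp by simp
      finally have "\<nu> k a = ennreal (real (n k * d k) / d k)"
        using mult(2) by (auto simp: \<nu>_def scaled_order_def a_def G(3))
      then show ?thesis using d[of k] by (simp add: ennreal_of_nat_eq_real_of_nat)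
    qed
    moreover have "a \<in> carrier (holomorphic_ring X \<A>)"
      unfolding a_def by (intro restrict_in_carrier holomorphic_fun_compose[OF H F]) auto
    ultimately show ?thesis unfolding \<beta> by (intro bexI[of _ a]) simp_all
  qed
  ultimately show ?thesis
    unfolding ample_def using cring_holomorphic_ring by blast
qed

end
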